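(* Let $k$ be a field, $R$ a $k$-algebra, and $p\in R$ an element such that $1\in pR$ but $1\notin Rp$. Let $B=B_{++}\cup B_{+-}$, where $B_{++}$ is any $k$-basis of $Rp=pRp$ containing $p$, and $B_{+-}$ is any $k$-basis of $R=pR$ relative to $Rp+k$ (so that $B\cup\{1\}$ is a $k$-basis of $R$). Let $$R'=R\langle q\mid pqp=p\rangle=R\langle q\mid pq=1\rangle .$$ Then $R'$ has a $k$-basis given by the words in $B\cup\{q\}$ which contain no subwords either of the form $xy$ with $x,y\in B$, or of the form $(xp)\,q$ with $xp\in B_{++}$. Any expression in these generators can be reduced to a linear combination of such words via the system of reductions $$xy\mapsto (xy)_R\quad\text{for all }x,y\in B,\qquad (xp)\,q\mapsto x_R\quad\text{for all }xp\in B_{++}.$$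
   Context: All rings are associative with unit, and for a nonzero $k$-algebra the $k$-subspace spanned by $1$ is identified with $k$. $R\langle q\mid pqp=p\rangle$ is the $k$-algebra obtained from $R$ by freely adjoining $q$ subject to the indicated relation. If $U\subseteq V$ are $k$-vector spaces, a $k$-basis of $V$ relative to $U$ is a subset $B\subseteq V$ such that every element of $V$ can be written uniquely as the sum of an element of $U$ and a $k$-linear combination of elements of $B$. Elements of $B$ are single letters; an element of $B_{++}$ is written $(xp)$ with $x\in R$, and since $p$ has a right inverse in $R$, $xp$ determines $x$. For an expression $f$ representing an element of $R$, $f_R$ denotes the unique $k$-linear combination of elements of $B\cup\{1\}$ giving its value in $R$. A word is a member of the free monoid on the generating set $G=B\cup\{q\}$ inside the free algebra $k\langle G\rangle$ (the empty word is $1$). A family of words gives a $k$-basis of $R'$ if it maps one-to-one into $R'$ with image a $k$-basis. A reduction $W\mapsto f$ permits replacing any word $uWv$ occurring in an element of $k\langle G\rangle$ by $ufv$. *)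

theory Defs
  imports
    Complex_Main
    "HOL-Library.Poly_Mapping"
    "HOL-Library.Sublist"
    "HOL-Algebra.QuotRing"
    "HOL-Algebra.Module"
begin

section \<open>Algebras over a field and bases\<close>

locale assoc_algebra = vector_space scale
  for scale :: "'k::field \<Rightarrow> 'r::ring_1 \<Rightarrow> 'r" +
  assumes scale_mult_left: "scale c x * y = scale c (x * y)"
    and scale_mult_right: "x * scale c y = scale c (x * y)"

definition basis_of :: "('k::field \<Rightarrow> 'v::ab_group_add \<Rightarrow> 'v) \<Rightarrow> 'v set \<Rightarrow> 'v set \<Rightarrow> bool" where
  "basis_of scale V B \<longleftrightarrow> \<not> module.dependent scale B \<and> module.span scale B = V"

text \<open>Families of coefficients of linear combinations are elements of \<open>'v \<Rightarrow>\<^sub>0 'k\<close>, i.e. finitely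
  supported functions.\<close>

definition relative_basis_of ::
  "('k::field \<Rightarrow> 'v::ab_group_add \<Rightarrow> 'v) \<Rightarrow> 'v set \<Rightarrow> 'v set \<Rightarrow> 'v set \<Rightarrow> bool" where
  "relative_basis_of scale U V B \<longleftrightarrow> B \<subseteq> V \<and>
    (\<forall>v\<in>V. \<exists>!(u, c). u \<in> U \<and> Poly_Mapping.keys c \<subseteq> B \<and>
       v = u + (\<Sum>b\<in>Poly_Mapping.keys c. scale (Poly_Mapping.lookup c b) b))"

text \<open>The same notion for an algebra given by a carrier set, as needed for a quotient whose type
  cannot depend on the ideal.\<close>

definition carrier_basis :: "('k::field, 'a) module \<Rightarrow> 'a set \<Rightarrow> bool" where
  "carrier_basis M B \<longleftrightarrow> B \<subseteq> carrier M \<and>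
    (\<forall>v\<in>carrier M. \<exists>!c. Poly_Mapping.keys c \<subseteq> B \<and>
       v = (\<Oplus>\<^bsub>M\<^esub>b\<in>Poly_Mapping.keys c. Poly_Mapping.lookup c b \<odot>\<^bsub>M\<^esub> b))"

section \<open>Free algebras\<close>

text \<open>With lists as a monoid under concatenation, the convolution product makes
  \<open>'g list \<Rightarrow>\<^sub>0 'k\<close> the free algebra on \<open>'g\<close>.\<close>

instantiation list :: (type) monoid_add
begin
definition zero_list :: "'a list" where "zero_list = []"
definition plus_list :: "'a list \<Rightarrow> 'a list \<Rightarrow> 'a list" where "plus_list u v = u @ v"
instance by standard (simp_all add: zero_list_def plus_list_def)
end

abbreviation word :: "'g list \<Rightarrow> ('g list \<Rightarrow>\<^sub>0 'k::field)" where
  "word w \<equiv> Poly_Mapping.single w 1"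

definition fscale :: "'k::field \<Rightarrow> ('g list \<Rightarrow>\<^sub>0 'k) \<Rightarrow> ('g list \<Rightarrow>\<^sub>0 'k)" where
  "fscale c f = Poly_Mapping.map ((*) c) f"

definition free_algebra :: "('g list \<Rightarrow>\<^sub>0 'k::field) ring" where
  "free_algebra = \<lparr>carrier = UNIV, mult = (*), one = 1, zero = 0, add = (+)\<rparr>"

definition free_quotient :: "('g list \<Rightarrow>\<^sub>0 'k::field) set \<Rightarrow> ('k, ('g list \<Rightarrow>\<^sub>0 'k) set) module" where
  "free_quotient I = ring.extend (free_algebra Quot I)
     \<lparr>smult = (\<lambda>c A. \<Union>a\<in>A. I +>\<^bsub>free_algebra\<^esub> fscale c a)\<rparr>"

definition free_class :: "('g list \<Rightarrow>\<^sub>0 'k::field) set \<Rightarrow> ('g list \<Rightarrow>\<^sub>0 'k) \<Rightarrow> ('g list \<Rightarrow>\<^sub>0 'k) set" where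
  "free_class I f = I +>\<^bsub>free_algebra\<^esub> f"

section \<open>Adjoining an element to an algebra\<close>

datatype 'r letter = Elt 'r | Q

text \<open>\<open>R\<langle>q | S\<rangle>\<close> is presented by one generator \<open>Elt r\<close> for every \<open>r \<in> R\<close> together with \<open>Q\<close>,
  subject to all relations that hold in \<open>R\<close> and to the relations \<open>s = 0\<close> for \<open>s \<in> S\<close>.\<close>

definition algebra_relations ::
  "('k::field \<Rightarrow> 'r::ring_1 \<Rightarrow> 'r) \<Rightarrow> ('r letter list \<Rightarrow>\<^sub>0 'k) set" where
  "algebra_relations scale =
     {word [Elt (x + y)] - (word [Elt x] + word [Elt y]) | x y. True} \<union>
     {word [Elt (scale c x)] - fscale c (word [Elt x]) | c x. True} \<union>
     {word [Elt (x * y)] - word [Elt x] * word [Elt y] | x y. True} \<union>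
     {word [Elt 1] - 1}"

definition adjoin_ideal ::
  "('k::field \<Rightarrow> 'r::ring_1 \<Rightarrow> 'r) \<Rightarrow> ('r letter list \<Rightarrow>\<^sub>0 'k) set \<Rightarrow> ('r letter list \<Rightarrow>\<^sub>0 'k) set" where
  "adjoin_ideal scale S = Idl\<^bsub>free_algebra\<^esub> (algebra_relations scale \<union> S)"

definition adjoin ::
  "('k::field \<Rightarrow> 'r::ring_1 \<Rightarrow> 'r) \<Rightarrow> ('r letter list \<Rightarrow>\<^sub>0 'k) set
     \<Rightarrow> ('k, ('r letter list \<Rightarrow>\<^sub>0 'k) set) module" where
  "adjoin scale S = free_quotient (adjoin_ideal scale S)"

definition adjoin_class ::
  "('k::field \<Rightarrow> 'r::ring_1 \<Rightarrow> 'r) \<Rightarrow> ('r letter list \<Rightarrow>\<^sub>0 'k) set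
     \<Rightarrow> ('r letter list \<Rightarrow>\<^sub>0 'k) \<Rightarrow> ('r letter list \<Rightarrow>\<^sub>0 'k) set" where
  "adjoin_class scale S = free_class (adjoin_ideal scale S)"

section \<open>Words and reductions\<close>

definition generators :: "'r set \<Rightarrow> 'r letter set" where
  "generators B = insert Q (Elt ` B)"

definition irreducible_words :: "'r set \<Rightarrow> 'r set \<Rightarrow> 'r letter list set" where
  "irreducible_words B Bpp = {w \<in> lists (generators B).
     (\<forall>x\<in>B. \<forall>y\<in>B. \<not> sublist [Elt x, Elt y] w) \<and> (\<forall>b\<in>Bpp. \<not> sublist [Elt b, Q] w)}"

text \<open>The element \<open>f\<^sub>R\<close> of \<open>k\<langle>B\<rangle>\<close> representing \<open>r \<in> R\<close>: the basis element \<open>1\<close> of \<open>R\<close> becomes the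
  empty word, every other basis element a word of length one.\<close>

definition expand ::
  "('k::field \<Rightarrow> 'r::ring_1 \<Rightarrow> 'r) \<Rightarrow> 'r set \<Rightarrow> 'r \<Rightarrow> ('r letter list \<Rightarrow>\<^sub>0 'k)" where
  "expand scale B r =
     (let c = module.representation scale (insert 1 B) r in
      \<Sum>b | c b \<noteq> 0. Poly_Mapping.single (if b = 1 then [] else [Elt b]) (c b))"

definition reduction_system ::
  "('k::field \<Rightarrow> 'r::ring_1 \<Rightarrow> 'r) \<Rightarrow> 'r \<Rightarrow> 'r set \<Rightarrow> 'r set
     \<Rightarrow> ('r letter list \<times> ('r letter list \<Rightarrow>\<^sub>0 'k)) set" where
  "reduction_system scale p B Bpp =
     {([Elt x, Elt y], expand scale B (x * y)) | x y. x \<in> B \<and> y \<in> B} \<union>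
     {([Elt (x * p), Q], expand scale B x) | x. x * p \<in> Bpp}"

text \<open>A reduction step replaces the word \<open>uWv\<close>, with its coefficient, by \<open>ufv\<close>.\<close>

inductive reduces ::
  "('g list \<times> ('g list \<Rightarrow>\<^sub>0 'k::field)) set \<Rightarrow> ('g list \<Rightarrow>\<^sub>0 'k) \<Rightarrow> ('g list \<Rightarrow>\<^sub>0 'k) \<Rightarrow> bool"
  for S where
  "(W, f) \<in> S \<Longrightarrow> u @ W @ v \<in> Poly_Mapping.keys a \<Longrightarrow>
   reduces S a (a - fscale (Poly_Mapping.lookup a (u @ W @ v)) (word (u @ W @ v))
                  + fscale (Poly_Mapping.lookup a (u @ W @ v)) (word u * f * word v))"

end

theory Submission
  imports Defs
begin

text \<open>
  Every reduction replaces a word of length 2 by a combination of words of length at most 1, so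
  reducing terminates, and irreducible words span. For their independence, let \<open>R\<langle>q\<rangle>\<close> act from the
  right on a free right \<open>R\<close>-module whose basis elements are the irreducible words that are empty or
  end in \<open>q\<close>; an irreducible word \<open>u b\<close> with \<open>b \<in> B\<close> stands for \<open>u \<otimes> b\<close>. Multiplication by \<open>q\<close> sends
  \<open>u \<otimes> xp\<close> to \<open>u \<otimes> x\<close>, \<open>u \<otimes> b\<close> with \<open>b \<in> B\<^sub>+\<^sub>-\<close> to \<open>u b q \<otimes> 1\<close>, and \<open>u \<otimes> 1\<close> to \<open>u q \<otimes> 1\<close>. Hence \<open>pq\<close> acts as
  the identity, and an irreducible word applied to the generator at the empty word yields the
  element it stands for; no ambiguities between reductions have to be resolved.
\<close>

section \<open>Free algebras and their quotients\<close>

lemma poly_mapping_sum_single: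
  fixes f :: "'a \<Rightarrow>\<^sub>0 'b::comm_monoid_add"
  shows "f = (\<Sum>w\<in>Poly_Mapping.keys f. Poly_Mapping.single w (Poly_Mapping.lookup f w))"
  by (rule poly_mapping_eqI)
    (simp add: lookup_sum lookup_single when_def not_in_keys_iff_lookup_eq_zero)

text \<open>Reduces additive properties to monomials; the zero function needs no case of its own,
  being a monomial with coefficient 0.\<close>

lemma poly_mapping_single_add_induct [case_names single add]:
  fixes f :: "'a \<Rightarrow>\<^sub>0 'b::comm_monoid_add"
  assumes single: "\<And>w c. P (Poly_Mapping.single w c)"
    and add: "\<And>f g. P f \<Longrightarrow> P g \<Longrightarrow> P (f + g)"
  shows "P f"
proof -
  have "P (\<Sum>w\<in>A. Poly_Mapping.single w (Poly_Mapping.lookup f w))" if "finite A" for A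
    using that
  proof (induction A rule: finite_induct)
    case empty
    show ?case using single[of _ 0] by simp
  next
    case (insert x F)
    then show ?case using add single by simp
  qed
  then show ?thesis
    by (subst poly_mapping_sum_single) simp
qed

lemma single_mult_single_list:
  "Poly_Mapping.single u a * Poly_Mapping.single v b = Poly_Mapping.single (u @ v) (a * b)"
  by (simp add: mult_single plus_list_def)

text \<open>Scalars act as multiples of the empty word, so compatibility with scalars follows from
  compatibility with products.\<close>

lemma fscale_single_mult: "fscale c f = Poly_Mapping.single [] c * f"
  by (simp add: fscale_def mult_map_scale_conv_mult zero_list_def)

lemma lookup_fscale: "Poly_Mapping.lookup (fscale c f) w = c * Poly_Mapping.lookup f w"
  by (simp add: fscale_def Poly_Mapping.map.rep_eq when_def)

lemma fscale_single: "fscale c (Poly_Mapping.single w a) = Poly_Mapping.single w (c * a)"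
  by (simp add: fscale_single_mult single_mult_single_list)

lemma free_algebra_simps [simp]:
  "carrier free_algebra = UNIV" "mult free_algebra = (*)" "one free_algebra = 1"
  "zero free_algebra = 0" "add free_algebra = (+)"
  by (simp_all add: free_algebra_def)

lemma free_algebra_abelian_group: "abelian_group free_algebra"
proof (rule abelian_groupI)
  show "\<exists>y\<in>carrier free_algebra. y \<oplus>\<^bsub>free_algebra\<^esub> x = \<zero>\<^bsub>free_algebra\<^esub>"
    for x :: "'a list \<Rightarrow>\<^sub>0 'b"
    by (intro bexI[of _ "- x"]) auto
qed (auto simp: algebra_simps)

lemma free_algebra_ring: "ring free_algebra"
  by (rule ringI[OF free_algebra_abelian_group])
    (auto simp: algebra_simps intro!: Group.monoidI)

lemma free_algebra_a_inv: "a_inv free_algebra f = - f"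
  by (rule abelian_group.minus_equality[OF free_algebra_abelian_group]) auto

text \<open>Closure under multiplication by monomials suffices, since every element is a sum of
  monomials. Negation is multiplication by the monomial with coefficient -1 at the empty
  word.\<close>

lemma ideal_free_algebraI:
  assumes add: "\<And>f g. f \<in> J \<Longrightarrow> g \<in> J \<Longrightarrow> f + g \<in> J"
    and zero: "0 \<in> J"
    and left: "\<And>w c f. f \<in> J \<Longrightarrow> Poly_Mapping.single w c * f \<in> J"
    and right: "\<And>w c f. f \<in> J \<Longrightarrow> f * Poly_Mapping.single w c \<in> J"
  shows "ideal J free_algebra"
proof (rule idealI[OF free_algebra_ring])
  have neg: "- f \<in> J" if "f \<in> J" for f
    using left[OF that, of 0 "-1"] by (simp add: single_uminus)
  show "subgroup J (add_monoid free_algebra)"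
  proof (rule subgroup.intro)
    show "inv\<^bsub>add_monoid free_algebra\<^esub> x \<in> J" if "x \<in> J" for x
      using neg[OF that] free_algebra_a_inv[of x] by (simp add: a_inv_def)
  qed (auto simp: add zero)
  fix a x assume a: "a \<in> J"
  show "x \<otimes>\<^bsub>free_algebra\<^esub> a \<in> J"
    by (induction x rule: poly_mapping_single_add_induct) (auto simp: distrib_right add left a)
  show "a \<otimes>\<^bsub>free_algebra\<^esub> x \<in> J"
    by (induction x rule: poly_mapping_single_add_induct) (auto simp: distrib_left add right a)
qed

section \<open>Congruence modulo an ideal and the quotient algebra\<close>

locale free_algebra_ideal =
  fixes I :: "('g list \<Rightarrow>\<^sub>0 'k::field) set"
  assumes ideal: "ideal I free_algebra"
begin

lemma zero_closed: "0 \<in> I"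
  using additive_subgroup.zero_closed[OF ideal.axioms(1)[OF ideal]] by simp

lemma add_closed: "f \<in> I \<Longrightarrow> g \<in> I \<Longrightarrow> f + g \<in> I"
  using additive_subgroup.a_closed[OF ideal.axioms(1)[OF ideal]] by simp

lemma left_closed: "f \<in> I \<Longrightarrow> h * f \<in> I"
  using ideal.I_l_closed[OF ideal, of f h] by simp

lemma right_closed: "f \<in> I \<Longrightarrow> f * h \<in> I"
  using ideal.I_r_closed[OF ideal, of f h] by simp

lemma uminus_closed: "f \<in> I \<Longrightarrow> - f \<in> I"
  using left_closed[of f "- 1"] by simp

lemma fscale_closed: "f \<in> I \<Longrightarrow> fscale c f \<in> I"
  by (simp add: fscale_single_mult left_closed)

definition cong (infix \<open>\<approx>\<close> 50) where "f \<approx> g \<longleftrightarrow> f - g \<in> I"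

lemma cong_refl [simp]: "f \<approx> f"
  by (simp add: cong_def zero_closed)

lemma cong_sym: "f \<approx> g \<Longrightarrow> g \<approx> f"
  using uminus_closed[of "f - g"] by (simp add: cong_def)

lemma cong_trans [trans]: "f \<approx> g \<Longrightarrow> g \<approx> h \<Longrightarrow> f \<approx> h"
  using add_closed[of "f - g" "g - h"] by (simp add: cong_def)

lemma cong_add: "f \<approx> g \<Longrightarrow> f' \<approx> g' \<Longrightarrow> f + f' \<approx> g + g'"
  using add_closed[of "f - g" "f' - g'"] by (simp add: cong_def algebra_simps)

lemma cong_mult: "f \<approx> g \<Longrightarrow> f' \<approx> g' \<Longrightarrow> f * f' \<approx> g * g'"
  using add_closed[OF right_closed[of "f - g" f'] left_closed[of "f' - g'" g]]
  by (simp add: cong_def algebra_simps)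

lemma cong_fscale: "f \<approx> g \<Longrightarrow> fscale c f \<approx> fscale c g"
  by (simp add: fscale_single_mult cong_mult)

lemma cong_sum: "(\<And>i. i \<in> A \<Longrightarrow> f i \<approx> g i) \<Longrightarrow> sum f A \<approx> sum g A"
  by (induction A rule: infinite_finite_induct) (auto intro: cong_add)

lemma free_class_alt: "free_class I f = {g. g \<approx> f}"
proof -
  have "g \<in> free_class I f \<longleftrightarrow> g \<approx> f" for g
  proof -
    have "g \<in> free_class I f \<longleftrightarrow> (\<exists>i\<in>I. g = i + f)"
      by (simp add: free_class_def a_r_coset_def r_coset_def)
    also have "\<dots> \<longleftrightarrow> g - f \<in> I"
      by (metis add_diff_cancel_right' diff_add_cancel)
    finally show ?thesis by (simp add: cong_def)
  qed
  then show ?thesis by auto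
qed

lemma free_class_eq_iff: "free_class I f = free_class I g \<longleftrightarrow> f \<approx> g"
  unfolding free_class_alt using cong_refl cong_sym cong_trans by blast

lemma carrier_free_quotient: "carrier (free_quotient I) = range (free_class I)"
  by (auto simp: free_quotient_def ring.defs FactRing_def A_RCOSETS_def RCOSETS_def
      free_class_def a_r_coset_def)

lemma add_free_quotient:
  "free_class I f \<oplus>\<^bsub>free_quotient I\<^esub> free_class I g = free_class I (f + g)"
  using abelian_subgroup.a_rcos_sum[OF abelian_subgroupI3[OF ideal.axioms(1)[OF ideal] free_algebra_abelian_group], of f g]
  by (simp add: free_quotient_def ring.defs FactRing_def free_class_def)

lemma zero_free_quotient: "\<zero>\<^bsub>free_quotient I\<^esub> = free_class I 0"
  by (simp add: free_quotient_def ring.defs FactRing_def free_class_alt cong_def)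

text \<open>The union that defines the scalar product runs over a nonempty set of representatives,
  and all the cosets united coincide because congruence respects scalars.\<close>

lemma smult_free_quotient:
  "c \<odot>\<^bsub>free_quotient I\<^esub> free_class I f = free_class I (fscale c f)"
proof -
  have mem: "f \<in> free_class I f"
    by (simp add: free_class_alt)
  have "c \<odot>\<^bsub>free_quotient I\<^esub> free_class I f = (\<Union>a\<in>free_class I f. free_class I (fscale c a))"
    by (simp add: free_quotient_def ring.defs free_class_def)
  also have "\<dots> = (\<Union>a\<in>free_class I f. free_class I (fscale c f))"
    by (rule SUP_cong[OF refl], subst free_class_eq_iff) (simp add: free_class_alt cong_fscale)
  also have "\<dots> = free_class I (fscale c f)"
    using mem by auto
  finally show ?thesis .
qed

lemma abelian_monoid_free_quotient: "abelian_monoid (free_quotient I)"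
  by (rule abelian_monoidI)
    (auto simp: carrier_free_quotient add_free_quotient zero_free_quotient algebra_simps)

lemma finsum_free_quotient:
  assumes "finite A"
    and "\<And>b. b \<in> A \<Longrightarrow> h b = free_class I (g b)"
  shows "finsum (free_quotient I) h A = free_class I (sum g A)"
  using assms
proof (induction A rule: finite_induct)
  case empty
  then show ?case
    by (simp add: abelian_monoid.finsum_empty[OF abelian_monoid_free_quotient] zero_free_quotient)
next
  case (insert x F)
  then show ?case
    by (subst abelian_monoid.finsum_insert[OF abelian_monoid_free_quotient])
      (auto simp: carrier_free_quotient add_free_quotient)
qed

lemma inj_on_free_class_word:
  assumes "\<And>f. f \<in> I \<Longrightarrow> Poly_Mapping.keys f \<subseteq> W \<Longrightarrow> f = 0"
  shows "inj_on (\<lambda>w. free_class I (word w)) W"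
proof (rule inj_onI)
  fix v w assume vw: "v \<in> W" "w \<in> W" and "free_class I (word v) = free_class I (word w)"
  then have "word v - word w \<in> I"
    by (simp add: free_class_eq_iff cong_def)
  moreover have "Poly_Mapping.keys (word v - word w :: _ \<Rightarrow>\<^sub>0 'k) \<subseteq> W"
    using vw by (auto simp: in_keys_iff lookup_minus lookup_single when_def split: if_splits)
  ultimately have "word v - word w = (0 :: _ \<Rightarrow>\<^sub>0 'k)"
    by (rule assms)
  then have "Poly_Mapping.lookup (word v :: _ \<Rightarrow>\<^sub>0 'k) v = Poly_Mapping.lookup (word w) v"
    by simp
  then show "v = w"
    by (simp add: lookup_single when_def split: if_splits)
qed

text \<open>Independence makes the class map injective on \<open>W\<close>, so coefficient families
  on classes and on words of \<open>W\<close> correspond. \<open>ex\<close> then gives existence of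
  coordinates and \<open>indep\<close> their uniqueness.\<close>

lemma carrier_basis_free_class_words:
  assumes ex: "\<And>f. \<exists>g. Poly_Mapping.keys g \<subseteq> W \<and> f \<approx> g"
    and indep: "\<And>f. f \<in> I \<Longrightarrow> Poly_Mapping.keys f \<subseteq> W \<Longrightarrow> f = 0"
  shows "carrier_basis (free_quotient I) ((\<lambda>w. free_class I (word w)) ` W)"
proof -
  define cls :: "'g list \<Rightarrow> ('g list \<Rightarrow>\<^sub>0 'k) set" where "cls = (\<lambda>w. free_class I (word w))"
  have inj: "inj_on cls W"
    unfolding cls_def by (rule inj_on_free_class_word[OF indep])
  \<comment> \<open>Pulls a coefficient family on classes back to words, along the inverse of
    \<open>cls\<close> on \<open>W\<close>.\<close>
  define lift :: "(('g list \<Rightarrow>\<^sub>0 'k) set \<Rightarrow>\<^sub>0 'k) \<Rightarrow> ('g list \<Rightarrow>\<^sub>0 'k)"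
    where "lift c = (\<Sum>b\<in>Poly_Mapping.keys c.
      Poly_Mapping.single (inv_into W cls b) (Poly_Mapping.lookup c b))" for c
  have lookup_lift: "Poly_Mapping.lookup (lift c) w =
      (if w \<in> W then Poly_Mapping.lookup c (cls w) else 0)"
    if c: "Poly_Mapping.keys c \<subseteq> cls ` W" for c w
  proof -
    have "Poly_Mapping.lookup (lift c) w =
      (\<Sum>b\<in>Poly_Mapping.keys c. if b = cls w \<and> w \<in> W then Poly_Mapping.lookup c b else 0)"
      unfolding lift_def lookup_sum
      using c inj by (intro sum.cong refl) (auto simp: lookup_single when_def)
    also have "\<dots> = (if w \<in> W then Poly_Mapping.lookup c (cls w) else 0)"
      by (simp add: not_in_keys_iff_lookup_eq_zero)
    finally show ?thesis .
  qed
  have keys_lift: "Poly_Mapping.keys (lift c) \<subseteq> W" if "Poly_Mapping.keys c \<subseteq> cls ` W" for c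
    using lookup_lift[OF that] by (auto simp: in_keys_iff split: if_splits)
  have comb: "(\<Oplus>\<^bsub>free_quotient I\<^esub>b\<in>Poly_Mapping.keys c.
      Poly_Mapping.lookup c b \<odot>\<^bsub>free_quotient I\<^esub> b) = free_class I (lift c)"
    if "Poly_Mapping.keys c \<subseteq> cls ` W" for c
    unfolding lift_def
  proof (rule finsum_free_quotient)
    fix b assume "b \<in> Poly_Mapping.keys c"
    with that have "cls (inv_into W cls b) = b"
      by (meson f_inv_into_f subsetD)
    then have "Poly_Mapping.lookup c b \<odot>\<^bsub>free_quotient I\<^esub> b =
      Poly_Mapping.lookup c b \<odot>\<^bsub>free_quotient I\<^esub> free_class I (word (inv_into W cls b))"
      by (simp add: cls_def)
    then show "Poly_Mapping.lookup c b \<odot>\<^bsub>free_quotient I\<^esub> b =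
      free_class I (Poly_Mapping.single (inv_into W cls b) (Poly_Mapping.lookup c b))"
      by (simp add: smult_free_quotient fscale_single)
  qed simp
  have "\<exists>!c. Poly_Mapping.keys c \<subseteq> cls ` W \<and> v = (\<Oplus>\<^bsub>free_quotient I\<^esub>b\<in>Poly_Mapping.keys c.
      Poly_Mapping.lookup c b \<odot>\<^bsub>free_quotient I\<^esub> b)"
    if v: "v \<in> carrier (free_quotient I)" for v
  proof -
    obtain f where f: "v = free_class I f"
      using v by (auto simp: carrier_free_quotient)
    obtain g where g: "Poly_Mapping.keys g \<subseteq> W" "f \<approx> g"
      using ex by blast
    \<comment> \<open>The push-forward of the representative \<open>g\<close> along
      \<open>cls\<close>, hence a preimage of \<open>g\<close> under \<open>lift\<close>.\<close>
    define c where "c = (\<Sum>w\<in>Poly_Mapping.keys g.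
      Poly_Mapping.single (cls w) (Poly_Mapping.lookup g w))"
    have lookup_c: "Poly_Mapping.lookup c b =
        (\<Sum>w\<in>Poly_Mapping.keys g. if cls w = b then Poly_Mapping.lookup g w else 0)" for b
      by (simp add: c_def lookup_sum lookup_single when_def)
    have keys_c: "Poly_Mapping.keys c \<subseteq> cls ` W"
    proof
      fix b assume "b \<in> Poly_Mapping.keys c"
      then have "(\<Sum>w\<in>Poly_Mapping.keys g. if cls w = b then Poly_Mapping.lookup g w else 0) \<noteq> 0"
        by (simp add: in_keys_iff lookup_c)
      then obtain w where "w \<in> Poly_Mapping.keys g" "cls w = b"
        by (rule sum.not_neutral_contains_not_neutral) (auto split: if_splits)
      then show "b \<in> cls ` W" using g by auto
    qed
    have "lift c = g"
    proof (rule poly_mapping_eqI)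
      fix w
      show "Poly_Mapping.lookup (lift c) w = Poly_Mapping.lookup g w"
      proof (cases "w \<in> W")
        case True
        have "Poly_Mapping.lookup c (cls w) =
          (\<Sum>w'\<in>Poly_Mapping.keys g. if w' = w then Poly_Mapping.lookup g w' else 0)"
          unfolding lookup_c using True g(1) inj
          by (intro sum.cong refl) (auto dest: inj_onD)
        with True show ?thesis
          by (simp add: lookup_lift[OF keys_c] not_in_keys_iff_lookup_eq_zero)
      next
        case False
        then show ?thesis
          using g(1) by (auto simp: lookup_lift[OF keys_c] not_in_keys_iff_lookup_eq_zero[symmetric])
      qed
    qed
    with g(2) f have v_eq: "v = free_class I (lift c)"
      by (simp add: free_class_eq_iff)
    show ?thesis
    proof (rule ex1I[of _ c])
      show "Poly_Mapping.keys c \<subseteq> cls ` W \<and> v = (\<Oplus>\<^bsub>free_quotient I\<^esub>b\<in>Poly_Mapping.keys c.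
        Poly_Mapping.lookup c b \<odot>\<^bsub>free_quotient I\<^esub> b)"
        using keys_c v_eq comb by simp
      fix d assume d: "Poly_Mapping.keys d \<subseteq> cls ` W \<and> v = (\<Oplus>\<^bsub>free_quotient I\<^esub>b\<in>Poly_Mapping.keys d.
        Poly_Mapping.lookup d b \<odot>\<^bsub>free_quotient I\<^esub> b)"
      then have "free_class I (lift d) = free_class I (lift c)"
        using comb v_eq by simp
      then have "lift d - lift c \<in> I"
        by (simp add: free_class_eq_iff cong_def)
      moreover have "Poly_Mapping.keys (lift d - lift c) \<subseteq> W"
        using keys_lift[of d] keys_lift[OF keys_c] d
        by (auto simp: in_keys_iff lookup_minus lookup_lift keys_c split: if_splits)
      ultimately have "lift d - lift c = 0"
        by (rule indep)
      then have eq: "lift d = lift c" by simp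
      show "d = c"
      proof (rule poly_mapping_eqI)
        fix b
        show "Poly_Mapping.lookup d b = Poly_Mapping.lookup c b"
        proof (cases "b \<in> cls ` W")
          case True
          then obtain w where w: "w \<in> W" "b = cls w" by auto
          then show ?thesis
            using arg_cong[OF eq, of "\<lambda>f. Poly_Mapping.lookup f w"] d keys_c
            by (simp add: lookup_lift)
        next
          case False
          then show ?thesis
            using d keys_c by (metis in_keys_iff subset_iff)
        qed
      qed
    qed
  qed
  then show ?thesis
    unfolding carrier_basis_def cls_def by (auto simp: carrier_free_quotient)
qed

end

section \<open>Reductions\<close>

text \<open>The coefficient at \<open>w\<close> cancels in the difference, so \<open>w\<close> can
  survive only through \<open>f\<close>.\<close>

lemma keys_diff_add_subset:
  "Poly_Mapping.keys (a - fscale (Poly_Mapping.lookup a w) (word w) + fscale c f)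
    \<subseteq> (Poly_Mapping.keys a - {w}) \<union> Poly_Mapping.keys f"
  by (auto simp: in_keys_iff lookup_add lookup_minus lookup_fscale lookup_single when_def
      split: if_splits)

lemma keys_word_mult_word:
  "Poly_Mapping.keys (word u * f * word v) \<subseteq> (\<lambda>w. u @ w @ v) ` Poly_Mapping.keys f"
proof
  fix x assume "x \<in> Poly_Mapping.keys (word u * f * word v)"
  then obtain a b where ab: "x = a + b" "a \<in> Poly_Mapping.keys (word u * f)"
    "b \<in> Poly_Mapping.keys (word v :: 'a list \<Rightarrow>\<^sub>0 'b)"
    using keys_mult[of "word u * f" "word v"] by blast
  moreover from ab(2) obtain c d where "a = c + d" "c \<in> Poly_Mapping.keys (word u :: 'a list \<Rightarrow>\<^sub>0 'b)"
    "d \<in> Poly_Mapping.keys f"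
    using keys_mult[of "word u" f] by blast
  ultimately show "x \<in> (\<lambda>w. u @ w @ v) ` Poly_Mapping.keys f"
    by (auto simp: plus_list_def)
qed

lemma keys_mult_lists:
  assumes "Poly_Mapping.keys f \<subseteq> lists G" and "Poly_Mapping.keys g \<subseteq> lists G"
  shows "Poly_Mapping.keys (f * g) \<subseteq> lists G"
proof
  fix x assume "x \<in> Poly_Mapping.keys (f * g)"
  then obtain a b where "x = a + b" "a \<in> Poly_Mapping.keys f" "b \<in> Poly_Mapping.keys g"
    using keys_mult[of f g] by blast
  moreover from this assms have "a \<in> lists G" "b \<in> lists G"
    by blast+
  ultimately show "x \<in> lists G"
    by (simp add: plus_list_def)
qed

text \<open>The case rule, enriched by a bound on the support of the result, so that invariants of
  supports can be checked without looking at coefficients.\<close>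

lemma reducesE:
  assumes "reduces S a b"
  obtains W f u v where "(W, f) \<in> S" "u @ W @ v \<in> Poly_Mapping.keys a"
    "b = a - fscale (Poly_Mapping.lookup a (u @ W @ v)) (word (u @ W @ v))
      + fscale (Poly_Mapping.lookup a (u @ W @ v)) (word u * f * word v)"
    "Poly_Mapping.keys b \<subseteq> (Poly_Mapping.keys a - {u @ W @ v})
      \<union> (\<lambda>w. u @ w @ v) ` Poly_Mapping.keys f"
  using assms
proof (cases rule: reduces.cases)
  case (1 W f u v)
  have "Poly_Mapping.keys b \<subseteq> (Poly_Mapping.keys a - {u @ W @ v})
      \<union> Poly_Mapping.keys (word u * f * word v)"
    unfolding 1(1) by (rule keys_diff_add_subset)
  also have "\<dots> \<subseteq> (Poly_Mapping.keys a - {u @ W @ v}) \<union> (\<lambda>w. u @ w @ v) ` Poly_Mapping.keys f"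
    by (intro Un_mono order_refl keys_word_mult_word)
  finally show ?thesis
    by (rule that[OF 1(2,3,1)])
qed

lemma reduces_keys_lists:
  assumes "reduces S a b" and "Poly_Mapping.keys a \<subseteq> lists G"
    and "\<And>W f. (W, f) \<in> S \<Longrightarrow> Poly_Mapping.keys f \<subseteq> lists G"
  shows "Poly_Mapping.keys b \<subseteq> lists G"
  using assms(1)
proof (rule reducesE)
  fix W f u v
  assume *: "(W, f) \<in> S" "u @ W @ v \<in> Poly_Mapping.keys a"
    "Poly_Mapping.keys b \<subseteq> (Poly_Mapping.keys a - {u @ W @ v})
      \<union> (\<lambda>w. u @ w @ v) ` Poly_Mapping.keys f"
  have "u @ W @ v \<in> lists G" "Poly_Mapping.keys f \<subseteq> lists G"
    using * assms(2,3) by auto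
  then have "(\<lambda>w. u @ w @ v) ` Poly_Mapping.keys f \<subseteq> lists G"
    by (auto dest!: subsetD)
  with *(3) assms(2) show ?thesis
    by blast
qed

lemma rtranclp_reduces_keys_lists:
  assumes "(reduces S)\<^sup>*\<^sup>* a b" and "Poly_Mapping.keys a \<subseteq> lists G"
    and "\<And>W f. (W, f) \<in> S \<Longrightarrow> Poly_Mapping.keys f \<subseteq> lists G"
  shows "Poly_Mapping.keys b \<subseteq> lists G"
  using assms(1) by induction (use assms(2,3) reduces_keys_lists in blast)+

lemma length_decreasing_normal_form:
  fixes S :: "('g list \<times> ('g list \<Rightarrow>\<^sub>0 'k::field)) set"
  defines "Red \<equiv> {w. \<exists>(W, f)\<in>S. sublist W w}"
  assumes decr: "\<And>W f w. (W, f) \<in> S \<Longrightarrow> w \<in> Poly_Mapping.keys f \<Longrightarrow> length w < length W"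
  shows "\<exists>b. (reduces S)\<^sup>*\<^sup>* a b \<and> Poly_Mapping.keys b \<inter> Red = {}"
  \<comment> \<open>A step at a longest reducible word removes that word and adds only shorter ones, so the number
    of reducible words of maximal length drops, even if coefficients cancel.\<close>
proof -
  have "\<exists>b. (reduces S)\<^sup>*\<^sup>* a b \<and> Poly_Mapping.keys b \<inter> Red = {}"
    if "\<And>w. w \<in> Poly_Mapping.keys a \<inter> Red \<Longrightarrow> length w < n" for n and a :: "'g list \<Rightarrow>\<^sub>0 'k"
    using that
  proof (induction n arbitrary: a)
    case 0
    then show ?case by blast
  next
    case (Suc n)
    \<comment> \<open>The outer induction bounds the lengths of reducible words, the inner one
      counts those of the largest length allowed. Once \<open>top a\<close> is empty, the bound
      drops to \<open>n\<close>.\<close>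
    define top where "top a = {w \<in> Poly_Mapping.keys a \<inter> Red. length w = n}"
      for a :: "'g list \<Rightarrow>\<^sub>0 'k"
    have "\<exists>b. (reduces S)\<^sup>*\<^sup>* a b \<and> Poly_Mapping.keys b \<inter> Red = {}"
      if "\<And>w. w \<in> Poly_Mapping.keys a \<inter> Red \<Longrightarrow> length w < Suc n" for a
      using that
    proof (induction "card (top a)" arbitrary: a rule: less_induct)
      case less
      show ?case
      proof (cases "top a = {}")
        case True
        then have "length w < n" if "w \<in> Poly_Mapping.keys a \<inter> Red" for w
          using less.prems[OF that] that unfolding top_def by (auto simp: less_Suc_eq)
        then show ?thesis by (rule Suc.IH)
      next
        case False
        then obtain w where w: "w \<in> Poly_Mapping.keys a" "w \<in> Red" "length w = n"
          by (auto simp: top_def)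
        then obtain W f u v where Wf: "(W, f) \<in> S" and w_eq: "w = u @ W @ v"
          by (auto simp: Red_def sublist_def)
        define b where "b = a - fscale (Poly_Mapping.lookup a w) (word w)
          + fscale (Poly_Mapping.lookup a w) (word u * f * word v)"
        have red: "reduces S a b"
          unfolding b_def w_eq by (rule reduces.intros[OF Wf]) (use w w_eq in simp)
        have short: "length x < n" if "x \<in> Poly_Mapping.keys (word u * f * word v)" for x
          using keys_word_mult_word[of u f v] that decr[OF Wf] w(3) w_eq by fastforce
        have keys_b: "Poly_Mapping.keys b
            \<subseteq> (Poly_Mapping.keys a - {w}) \<union> Poly_Mapping.keys (word u * f * word v)"
          unfolding b_def by (rule keys_diff_add_subset)
        have "top b \<subseteq> top a - {w}"
          using keys_b short by (fastforce simp: top_def)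
        moreover have "w \<in> top a" "finite (top a)"
          using w by (auto simp: top_def)
        ultimately have "card (top b) < card (top a)"
          by (intro psubset_card_mono) auto
        moreover have "length x < Suc n" if "x \<in> Poly_Mapping.keys b \<inter> Red" for x
          using keys_b that short less.prems less_SucI by blast
        ultimately have "\<exists>c. (reduces S)\<^sup>*\<^sup>* b c \<and> Poly_Mapping.keys c \<inter> Red = {}"
          by (rule less.hyps)
        with red show ?thesis
          by (meson converse_rtranclp_into_rtranclp)
      qed
    qed
    then show ?case using Suc.prems .
  qed
  \<comment> \<open>For \<open>a = 0\<close> the maximum is taken over the empty set, but the bound
    is then vacuous.\<close>
  moreover have "\<exists>n. \<forall>w\<in>Poly_Mapping.keys a \<inter> Red. length w < n"
    by (rule exI[of _ "Suc (Max (length ` Poly_Mapping.keys a))"]) (auto simp: less_Suc_eq_le)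
  ultimately show ?thesis by blast
qed

context free_algebra_ideal
begin

text \<open>The change made by a step is a scalar multiple of
  \<open>word u * (f - word W) * word v\<close>, which lies in the two-sided ideal.\<close>

lemma reduces_cong:
  assumes "reduces S a b" and S: "\<And>W f. (W, f) \<in> S \<Longrightarrow> word W \<approx> f"
  shows "b \<approx> a"
  using assms(1)
proof (rule reducesE)
  fix W f u v
  assume Wf: "(W, f) \<in> S" and b: "b = a - fscale (Poly_Mapping.lookup a (u @ W @ v)) (word (u @ W @ v))
      + fscale (Poly_Mapping.lookup a (u @ W @ v)) (word u * f * word v)"
  have "word u * f * word v - word (u @ W @ v) = word u * (f - word W) * word v"
    by (simp add: algebra_simps single_mult_single_list)
  also have "\<dots> \<in> I"
    using cong_sym[OF S[OF Wf]] by (simp add: cong_def left_closed right_closed)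
  finally have "fscale (Poly_Mapping.lookup a (u @ W @ v)) (word u * f * word v - word (u @ W @ v)) \<in> I"
    by (rule fscale_closed)
  then show "b \<approx> a"
    by (simp add: cong_def b fscale_single_mult algebra_simps)
qed

lemma rtranclp_reduces_cong:
  assumes "(reduces S)\<^sup>*\<^sup>* a b" and S: "\<And>W f. (W, f) \<in> S \<Longrightarrow> word W \<approx> f"
  shows "b \<approx> a"
  using assms(1) by induction (auto intro: cong_trans[OF reduces_cong] S)

end

section \<open>The presentation\<close>

context assoc_algebra
begin

lemma ideal_adjoin_ideal: "ideal (adjoin_ideal scale S) free_algebra"
  unfolding adjoin_ideal_def
  by (rule ring.genideal_ideal[OF free_algebra_ring]) simp

text \<open>\<open>adj.cong S\<close> is equality in the algebra presented by \<open>S\<close>;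
  \<open>S\<close> stays a parameter because two presentations are compared.\<close>

sublocale adj: free_algebra_ideal "adjoin_ideal scale S" for S
  by (rule free_algebra_ideal.intro) (rule ideal_adjoin_ideal)

lemma adjoin_ideal_superset: "algebra_relations scale \<union> S \<subseteq> adjoin_ideal scale S"
  unfolding adjoin_ideal_def
  by (rule ring.genideal_self[OF free_algebra_ring]) simp

lemma adjoin_ideal_minimal:
  "ideal J free_algebra \<Longrightarrow> algebra_relations scale \<union> S \<subseteq> J \<Longrightarrow> adjoin_ideal scale S \<subseteq> J"
  unfolding adjoin_ideal_def
  by (rule ring.genideal_minimal[OF free_algebra_ring])

lemma
  shows Elt_add: "adj.cong S (word [Elt (x + y)]) (word [Elt x] + word [Elt y])"
    and Elt_scale: "adj.cong S (word [Elt (scale c x)]) (fscale c (word [Elt x]))"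
    and Elt_mult: "adj.cong S (word [Elt (x * y)]) (word [Elt x] * word [Elt y])"
    and Elt_one: "adj.cong S (word [Elt 1]) 1"
  unfolding adj.cong_def
  by (rule subsetD[OF adjoin_ideal_superset], unfold algebra_relations_def, blast)+

lemma Elt_sum: "adj.cong S (word [Elt (\<Sum>i\<in>A. scale (c i) (f i))]) (\<Sum>i\<in>A. fscale (c i) (word [Elt (f i)]))"
proof (induction A rule: infinite_finite_induct)
  case (infinite A)
  \<comment> \<open>The sum over an infinite set is 0, and \<open>Elt 0\<close> vanishes by the
    scalar relation with coefficient 0.\<close>
  then show ?case using Elt_scale[of S 0 0] by (simp add: fscale_single)
next
  case empty
  then show ?case using Elt_scale[of S 0 0] by (simp add: fscale_single)
next
  case (insert x F)
  have "adj.cong S (word [Elt (scale (c x) (f x) + (\<Sum>i\<in>F. scale (c i) (f i)))])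
    (word [Elt (scale (c x) (f x))] + word [Elt (\<Sum>i\<in>F. scale (c i) (f i))])"
    by (rule Elt_add)
  also have "adj.cong S \<dots> (fscale (c x) (word [Elt (f x)]) + (\<Sum>i\<in>F. fscale (c i) (word [Elt (f i)])))"
    by (intro adj.cong_add Elt_scale insert.IH)
  finally show ?case using insert.hyps by simp
qed

text \<open>The source of termination: right-hand sides of reductions contain only words of length
  at most 1.\<close>

lemma keys_expand: "Poly_Mapping.keys (expand scale B r) \<subseteq> insert [] ((\<lambda>b. [Elt b]) ` B)"
proof -
  have "Poly_Mapping.keys (expand scale B r) \<subseteq>
    (\<Union>b\<in>{b. representation (insert 1 B) r b \<noteq> 0}.
      Poly_Mapping.keys (Poly_Mapping.single (if b = 1 then [] else [Elt b]) (representation (insert 1 B) r b)))"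
    unfolding expand_def Let_def by (rule keys_sum)
  also have "\<dots> \<subseteq> insert [] ((\<lambda>b. [Elt b]) ` B)"
    by (rule UN_least) (use representation_ne_zero[of "insert 1 B" r] in auto)
  finally show ?thesis .
qed

text \<open>Write \<open>r\<close> in the basis, push the sum through the linearity relations for
  \<open>Elt\<close>, and replace \<open>Elt 1\<close> by the empty word.\<close>

lemma Elt_expand:
  assumes "independent (insert 1 B)" and "r \<in> span (insert 1 B)"
  shows "adj.cong S (word [Elt r]) (expand scale B r)"
proof -
  define c where "c = representation (insert 1 B) r"
  have "adj.cong S (word [Elt (\<Sum>b | c b \<noteq> 0. scale (c b) b)]) (\<Sum>b | c b \<noteq> 0. fscale (c b) (word [Elt b]))"
    by (rule Elt_sum)
  also have "(\<Sum>b | c b \<noteq> 0. scale (c b) b) = r"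
    unfolding c_def by (rule sum_nonzero_representation_eq[OF assms])
  also have "adj.cong S (\<Sum>b | c b \<noteq> 0. fscale (c b) (word [Elt b]))
    (\<Sum>b | c b \<noteq> 0. fscale (c b) (if b = 1 then 1 else word [Elt b]))"
    by (intro adj.cong_sum adj.cong_fscale) (simp add: Elt_one)
  also have "(\<Sum>b | c b \<noteq> 0. fscale (c b) (if b = 1 then 1 else word [Elt b])) = expand scale B r"
    unfolding expand_def Let_def c_def[symmetric]
    by (intro sum.cong refl)
      (simp add: fscale_single zero_list_def flip: single_one)
  finally show ?thesis .
qed

text \<open>Each letter \<open>Elt r\<close> with arbitrary \<open>r\<close> is replaced by its
  expansion; products of expansions remain combinations of words in the generators.\<close>

lemma word_generators_spanning:
  assumes B: "independent (insert 1 B)" "span (insert 1 B) = UNIV"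
  shows "\<exists>g. Poly_Mapping.keys g \<subseteq> lists (generators B) \<and> adj.cong S f g"
proof (induction f rule: poly_mapping_single_add_induct)
  case (add f g)
  then obtain f' g' where "Poly_Mapping.keys f' \<subseteq> lists (generators B)" "adj.cong S f f'"
    "Poly_Mapping.keys g' \<subseteq> lists (generators B)" "adj.cong S g g'"
    by blast
  then show ?case
    using keys_add[of f' g'] by (intro exI[of _ "f' + g'"] conjI adj.cong_add) blast+
next
  case (single w c)
  have "\<exists>g. Poly_Mapping.keys g \<subseteq> lists (generators B) \<and> adj.cong S (word w) g"
  proof (induction w)
    case Nil
    show ?case by (intro exI[of _ "word []"]) simp
  next
    case (Cons a w)
    then obtain g where g: "Poly_Mapping.keys g \<subseteq> lists (generators B)" "adj.cong S (word w) g"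
      by blast
    have "\<exists>h. Poly_Mapping.keys h \<subseteq> lists (generators B) \<and> adj.cong S (word [a]) h"
    proof (cases a)
      case (Elt r)
      show ?thesis
        using Elt_expand[OF B(1), of r S] B(2) keys_expand[of B r] Elt
        by (intro exI[of _ "expand scale B r"]) (auto simp: generators_def)
    next
      case Q
      then show ?thesis by (intro exI[of _ "word [Q]"]) (simp add: generators_def)
    qed
    then obtain h where h: "Poly_Mapping.keys h \<subseteq> lists (generators B)" "adj.cong S (word [a]) h"
      by blast
    have "adj.cong S (word (a # w)) (h * g)"
      using adj.cong_mult[OF h(2) g(2)] by (simp add: single_mult_single_list)
    moreover have "Poly_Mapping.keys (h * g) \<subseteq> lists (generators B)"
      using h(1) g(1) by (rule keys_mult_lists)
    ultimately show ?case by blast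
  qed
  then obtain g where g: "Poly_Mapping.keys g \<subseteq> lists (generators B)" "adj.cong S (word w) g"
    by blast
  have "Poly_Mapping.keys (fscale c g) \<subseteq> Poly_Mapping.keys g"
    by (auto simp: in_keys_iff lookup_fscale)
  moreover have "adj.cong S (Poly_Mapping.single w c) (fscale c g)"
    using adj.cong_fscale[OF g(2), of c] by (simp add: fscale_single)
  ultimately show ?case using g(1) by blast
qed

end

section \<open>Linear extension of maps from words to the algebra\<close>

context assoc_algebra
begin

text \<open>The linear extension of \<open>\<phi>\<close>. It serves with \<open>\<phi> = id\<close>
  for combinations of basis elements, and with the action of words on a module vector, read off at
  one address.\<close>

definition lincomb :: "('w \<Rightarrow> 'r) \<Rightarrow> ('w \<Rightarrow>\<^sub>0 'k) \<Rightarrow> 'r" where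
  "lincomb \<phi> f = (\<Sum>w\<in>Poly_Mapping.keys f. scale (Poly_Mapping.lookup f w) (\<phi> w))"

lemma lincomb_alt:
  fixes f :: "'w \<Rightarrow>\<^sub>0 'k"
  shows "finite A \<Longrightarrow> Poly_Mapping.keys f \<subseteq> A \<Longrightarrow>
    lincomb \<phi> f = (\<Sum>w\<in>A. scale (Poly_Mapping.lookup f w) (\<phi> w))"
  unfolding lincomb_def by (rule sum.mono_neutral_left) (auto simp: in_keys_iff)

lemma lincomb_zero [simp]: "lincomb \<phi> 0 = 0"
  by (simp add: lincomb_def)

lemma lincomb_single [simp]: "lincomb \<phi> (Poly_Mapping.single w c) = scale c (\<phi> w)"
  by (subst lincomb_alt[of "{w}"]) auto

lemma lincomb_add: "lincomb \<phi> (f + g) = lincomb \<phi> f + lincomb \<phi> g"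
  using keys_add[of f g]
  by (simp add: lincomb_alt[of "Poly_Mapping.keys f \<union> Poly_Mapping.keys g"] lookup_add
      scale_left_distrib sum.distrib)

lemma lincomb_diff: "lincomb \<phi> (f - g) = lincomb \<phi> f - lincomb \<phi> g"
  using lincomb_add[of \<phi> "f - g" g] by simp

lemma lincomb_single_mult:
  "lincomb \<phi> (Poly_Mapping.single u c * f) = scale c (lincomb (\<lambda>w. \<phi> (u @ w)) f)"
  by (induction f rule: poly_mapping_single_add_induct)
    (simp_all add: single_mult_single_list distrib_left lincomb_add scale_right_distrib)

lemma lincomb_mult_single:
  "lincomb \<phi> (f * Poly_Mapping.single u c) = scale c (lincomb (\<lambda>w. \<phi> (w @ u)) f)"
  by (induction f rule: poly_mapping_single_add_induct)
    (simp_all add: single_mult_single_list distrib_right lincomb_add scale_right_distrib mult.commute)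

end

section \<open>Bases\<close>

text \<open>As 1 lies outside \<open>U\<close>, adding it to \<open>Bpp\<close> gives a basis of
  \<open>U + k\<close>. A basis relative to \<open>U + k\<close> then completes it to a basis of the
  whole space.\<close>

lemma (in assoc_algebra) relative_basis_insert_one:
  assumes Bpp: "basis_of scale U Bpp" and one: "1 \<notin> U"
    and Bpm: "relative_basis_of scale {u + z | u z. u \<in> U \<and> z \<in> span {1}} UNIV Bpm"
  shows "1 \<notin> Bpp \<union> Bpm" and "Bpp \<inter> Bpm = {}"
    and "independent (insert 1 (Bpp \<union> Bpm))" and "span (insert 1 (Bpp \<union> Bpm)) = UNIV"
proof -
  define U1 where "U1 = {u + z | u z. u \<in> U \<and> z \<in> span {1}}"
  have ind: "independent Bpp" and sp: "span Bpp = U"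
    using Bpp by (auto simp: basis_of_def)
  have U1: "U1 = span (insert 1 Bpp)"
    unfolding insert_is_Un[of 1 Bpp] span_Un sp U1_def by (auto simp: add.commute) (metis add.commute)+
  have ind1: "independent (insert 1 Bpp)"
    using ind one sp by (simp add: independent_insert span_base)
  have rep: "\<exists>!uc. fst uc \<in> U1 \<and> Poly_Mapping.keys (snd uc) \<subseteq> Bpm \<and> v = fst uc + lincomb id (snd uc)" for v
    using Bpm unfolding relative_basis_of_def U1_def[symmetric] lincomb_def
    by (simp add: case_prod_unfold)
  \<comment> \<open>0 also has the decomposition with zero summand and zero coefficients, and
    decompositions are unique.\<close>
  have uniq: "u = 0 \<and> c = 0"
    if "u \<in> U1" "Poly_Mapping.keys c \<subseteq> Bpm" "u + lincomb id c = 0" for u c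
  proof -
    note rep[of 0]
    moreover have "0 \<in> U1"
      unfolding U1 by (rule span_zero)
    ultimately have "(u, c) = (0, 0)"
      using that by (elim ex1E) (metis add_0 empty_subsetI fst_conv keys_zero lincomb_zero snd_conv)
    then show ?thesis by simp
  qed
  \<comment> \<open>Otherwise \<open>- b\<close> plus 1 times \<open>b\<close> would be a nontrivial
    decomposition of 0.\<close>
  have notin: "b \<notin> U1" if "b \<in> Bpm" for b
  proof
    assume "b \<in> U1"
    then have "- b = 0 \<and> Poly_Mapping.single b 1 = (0 :: 'r \<Rightarrow>\<^sub>0 'k)"
      using that unfolding U1 by (intro uniq) (auto simp: U1 span_neg)
    then show False
      by (metis lookup_single_eq lookup_zero zero_neq_one)
  qed
  have disj: "insert 1 Bpp \<inter> Bpm = {}"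
    using notin span_base[of _ "insert 1 Bpp"] unfolding U1 by blast
  then show "Bpp \<inter> Bpm = {}" "1 \<notin> Bpp \<union> Bpm"
    using one sp span_base by auto
  show "independent (insert 1 (Bpp \<union> Bpm))"
    unfolding independent_explicit_module
  proof (intro allI impI)
    fix T c b
    assume T: "finite T" "T \<subseteq> insert 1 (Bpp \<union> Bpm)" "(\<Sum>v\<in>T. scale (c v) v) = 0" "b \<in> T"
    define T1 where "T1 = T \<inter> insert 1 Bpp"
    define T2 where "T2 = T \<inter> Bpm"
    have fin: "finite T1" "finite T2" "T1 \<inter> T2 = {}" "T = T1 \<union> T2"
      using T disj by (auto simp: T1_def T2_def)
    \<comment> \<open>The coefficients on \<open>Bpm\<close> as a finitely supported function, so
      that \<open>uniq\<close> separates the two halves of the vanishing combination.\<close>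
    define d where "d = (\<Sum>v\<in>T2. Poly_Mapping.single v (c v))"
    have lookup_d: "Poly_Mapping.lookup d v = (if v \<in> T2 then c v else 0)" for v
      using fin by (simp add: d_def lookup_sum lookup_single when_def)
    have keys_d: "Poly_Mapping.keys d \<subseteq> T2"
      by (auto simp: in_keys_iff lookup_d split: if_splits)
    have "lincomb id d = (\<Sum>v\<in>T2. scale (c v) v)"
      by (simp add: lincomb_alt[OF fin(2) keys_d] lookup_d)
    moreover have "(\<Sum>v\<in>T1. scale (c v) v) + (\<Sum>v\<in>T2. scale (c v) v) = 0"
      using T(3) fin by (simp add: sum.union_disjoint)
    moreover have "(\<Sum>v\<in>T1. scale (c v) v) \<in> U1"
      unfolding U1 by (intro span_sum span_scale span_base) (auto simp: T1_def)
    ultimately have 0: "(\<Sum>v\<in>T1. scale (c v) v) = 0" "d = 0"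
      using uniq[of "\<Sum>v\<in>T1. scale (c v) v" d] keys_d by (auto simp: T2_def)
    show "c b = 0"
    proof (cases "b \<in> T1")
      case True
      with 0(1) fin(1) ind1 show ?thesis
        unfolding independent_explicit_module by (metis Int_lower2 T1_def)
    next
      case False
      with T(4) fin(4) have "b \<in> T2" by blast
      with 0(2) lookup_d[of b] show ?thesis by simp
    qed
  qed
  show "span (insert 1 (Bpp \<union> Bpm)) = UNIV"
  proof -
    have "v \<in> span (insert 1 (Bpp \<union> Bpm))" for v
    proof -
      obtain u c where uc: "u \<in> U1" "Poly_Mapping.keys c \<subseteq> Bpm" "v = u + lincomb id c"
        using rep[of v] by blast
      have "u \<in> span (insert 1 (Bpp \<union> Bpm))"
        using uc(1) span_mono[of "insert 1 Bpp" "insert 1 (Bpp \<union> Bpm)"] unfolding U1 by auto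
      moreover have "lincomb id c \<in> span (insert 1 (Bpp \<union> Bpm))"
        unfolding lincomb_def using uc(2) by (intro span_sum span_scale span_base) auto
      ultimately show ?thesis
        unfolding uc(3) by (rule span_add)
    qed
    then show ?thesis by auto
  qed
qed

section \<open>Adjoining a right inverse\<close>

text \<open>\<open>y\<close> is a fixed right inverse of \<open>p\<close>; right multiplication by
  it recovers \<open>x\<close> from \<open>x * p\<close>.\<close>

locale right_invertible_bases = assoc_algebra scale
  for scale :: "'k::field \<Rightarrow> 'r::ring_1 \<Rightarrow> 'r" +
  fixes p y :: 'r and Bpp Bpm :: "'r set"
  assumes p_y: "p * y = 1"
    and one_notin: "1 \<notin> {x * p | x. True}"
    and Bpp_basis: "basis_of scale {x * p | x. True} Bpp"
    and Bpm_basis: "relative_basis_of scale {x * p + z | x z. z \<in> span {1}} UNIV Bpm"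
begin

abbreviation "basis \<equiv> Bpp \<union> Bpm"

lemma xp_y [simp]: "x * p * y = x"
  by (simp add: mult.assoc p_y)

lemma
  shows one_notin_B: "1 \<notin> basis" and Bpp_Bpm_disjoint: "Bpp \<inter> Bpm = {}"
    and independent_insert_one: "independent (insert 1 basis)"
    and span_insert_one: "span (insert 1 basis) = UNIV"
proof -
  have eq: "{x * p + z | x z. z \<in> span {1}} = {u + z | u z. u \<in> {x * p | x. True} \<and> z \<in> span {1}}"
    by blast
  note * = relative_basis_insert_one[OF Bpp_basis one_notin Bpm_basis[unfolded eq]]
  show "1 \<notin> basis" "Bpp \<inter> Bpm = {}" "independent (insert 1 basis)" "span (insert 1 basis) = UNIV"
    by (fact *)+
qed

lemma span_Bpp: "span Bpp = {x * p | x. True}"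
  using Bpp_basis by (simp add: basis_of_def)

lemma Bpp_y_p: "b \<in> Bpp \<Longrightarrow> b * y * p = b"
  using span_base[of b Bpp] span_Bpp by auto

section \<open>Division by \<open>p\<close> and coordinates in the basis\<close>

interpretation self: vector_space_pair scale scale
  by unfold_locales

text \<open>Projects onto \<open>Rp\<close> along the span of \<open>B\<^sub>+\<^sub>- \<union> {1}\<close>, then divides by \<open>p\<close> on the right.\<close>

definition left_factor :: "'r \<Rightarrow> 'r" where
  "left_factor = self.construct (insert 1 basis) (\<lambda>b. if b \<in> Bpp then b * y else 0)"

lemma linear_left_factor: "Vector_Spaces.linear scale scale left_factor"
  unfolding left_factor_def by (rule self.linear_construct[OF independent_insert_one])

lemma left_factor_basis: "b \<in> insert 1 basis \<Longrightarrow> left_factor b = (if b \<in> Bpp then b * y else 0)"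
  unfolding left_factor_def by (rule self.construct_basis[OF independent_insert_one])

lemma linear_mult_right: "Vector_Spaces.linear scale scale (\<lambda>r. r * z)"
  by unfold_locales (simp_all add: distrib_right scale_mult_left)

text \<open>\<open>left_factor\<close> and right multiplication by \<open>y\<close> are linear and
  agree on \<open>Bpp\<close>, hence on its span \<open>Rp\<close>.\<close>

lemma left_factor_mult_p: "left_factor (x * p) = x"
proof -
  have "left_factor (x * p) = x * p * y"
  proof (rule self.linear_eq_on[OF linear_left_factor linear_mult_right[of y], of _ Bpp])
    show "x * p \<in> span Bpp"
      using span_Bpp by auto
  qed (simp add: left_factor_basis)
  then show ?thesis by simp
qed

abbreviation coef :: "'r \<Rightarrow> 'r \<Rightarrow> 'k" where
  "coef \<equiv> representation (insert 1 basis)"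

lemma coef_basis: "b \<in> insert 1 basis \<Longrightarrow> coef b c = (if c = b then 1 else 0)"
  using representation_basis[OF independent_insert_one] by simp

lemma coef_sum: "coef (\<Sum>i\<in>A. scale (c i) (f i)) b = (\<Sum>i\<in>A. c i * coef (f i) b)"
  by (subst representation_sum[OF independent_insert_one])
    (auto simp: span_insert_one representation_scale[OF independent_insert_one])

text \<open>Elements of \<open>Rp\<close> have coordinates only along \<open>Bpp\<close>. This makes
  the extra terms of the action of \<open>Q\<close> vanish after multiplication by
  \<open>p\<close>.\<close>

lemma coef_mult_p: "b \<notin> Bpp \<Longrightarrow> coef (x * p) b = 0"
proof -
  assume "b \<notin> Bpp"
  moreover have "x * p \<in> span Bpp"
    using span_Bpp by auto
  then have "coef (x * p) = representation Bpp (x * p)"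
    by (rule representation_extend[OF independent_insert_one]) blast
  ultimately show ?thesis
    using representation_ne_zero[of Bpp "x * p" b] by auto
qed

section \<open>The right module and its annihilator\<close>

text \<open>The module consists of all functions from words to \<open>R\<close> (finite support is never needed), and the
  basis element \<open>u\<close> is addressed by the reversal of \<open>u\<close>, so that the end of \<open>u\<close> is the head of the list.\<close>

definition act :: "'r letter \<Rightarrow> ('r letter list \<Rightarrow> 'r) \<Rightarrow> 'r letter list \<Rightarrow> 'r" where
  "act a v t = (case a of
      Elt r \<Rightarrow> v t * r
    | Q \<Rightarrow> left_factor (v t) + (case t of
        Q # u \<Rightarrow> scale (coef (v u) 1) 1 + (case u of
            Elt b # s \<Rightarrow> if b \<in> Bpm then scale (coef (v s) b) 1 else 0
          | _ \<Rightarrow> 0)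
      | _ \<Rightarrow> 0))"

lemma act_Elt [simp]: "act (Elt r) v = (\<lambda>t. v t * r)"
  by (simp add: act_def fun_eq_iff)

text \<open>\<open>act Q\<close> collects what arrives at address \<open>t\<close>: the quotient by
  \<open>p\<close> of the entry at \<open>t\<close>, and for \<open>t = Q # u\<close> the
  1-coordinate at \<open>u\<close> and, if \<open>u = Elt b # s\<close> with \<open>b\<close> in
  \<open>Bpm\<close>, the \<open>b\<close>-coordinate at \<open>s\<close>. Each contribution is
  linear in the vector.\<close>

lemma act_sum:
  "act a (\<lambda>t. \<Sum>i\<in>A. scale (c i) (v i t)) = (\<lambda>t. \<Sum>i\<in>A. scale (c i) (act a (v i) t))"
proof (cases a)
  case (Elt r)
  then show ?thesis by (simp add: sum_distrib_right scale_mult_left)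
next
  case Q
  have "left_factor (\<Sum>i\<in>A. scale (c i) (v i t)) = (\<Sum>i\<in>A. scale (c i) (left_factor (v i t)))" for t
    by (simp add: self.linear_sum[OF linear_left_factor] self.linear_scale[OF linear_left_factor])
  then show ?thesis
    unfolding act_def Q fun_eq_iff
    by (auto simp: coef_sum scale_sum_left scale_right_distrib sum.distrib
        split: list.split letter.split)
qed

lemma fold_act_sum:
  "fold act w (\<lambda>t. \<Sum>i\<in>A. scale (c i) (v i t)) = (\<lambda>t. \<Sum>i\<in>A. scale (c i) (fold act w (v i) t))"
  by (induction w arbitrary: v) (simp_all add: act_sum)

lemma fold_act_zero: "fold act w (\<lambda>t. 0) = (\<lambda>t. 0)"
  using fold_act_sum[of w _ _ "{}"] by simp

text \<open>The relation \<open>pq = 1\<close> on the module: all entries lie in \<open>Rp\<close>,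
  so they have no coordinate at 1 or in \<open>Bpm\<close>, and \<open>left_factor\<close> undoes
  the multiplication by \<open>p\<close>.\<close>

lemma act_Q_mult_p: "act Q (\<lambda>t. v t * p) = v"
proof -
  have "1 \<notin> Bpp" and "\<And>b. b \<in> Bpm \<Longrightarrow> b \<notin> Bpp"
    using one_notin_B Bpp_Bpm_disjoint by auto
  then show ?thesis
    by (auto simp: fun_eq_iff act_def left_factor_mult_p coef_mult_p split: list.split letter.split)
qed

text \<open>The kernel of a right action: \<open>fold\<close> applies the first letter first, so
  \<open>u @ w\<close> acts by \<open>u\<close> and then by \<open>w\<close>.\<close>

definition annihilator :: "('r letter list \<Rightarrow>\<^sub>0 'k) set" where
  "annihilator = {f. \<forall>v t. lincomb (\<lambda>w. fold act w v t) f = 0}"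

text \<open>A word multiplied on the left only changes the vector acted on, which is arbitrary; one
  multiplied on the right applies a linear map to the zero vector.\<close>

lemma ideal_annihilator: "ideal annihilator free_algebra"
proof (rule ideal_free_algebraI)
  fix w c f assume f: "f \<in> annihilator"
  have "(\<lambda>t. lincomb (\<lambda>u. fold act u v t) f) = (\<lambda>t. 0)" for v
    using f by (simp add: annihilator_def)
  then have "lincomb (\<lambda>u. fold act w (fold act u v) t) f = 0" for v t
    using fold_act_sum[of w "Poly_Mapping.lookup f" "\<lambda>u. fold act u v" "Poly_Mapping.keys f"]
    unfolding lincomb_def by (simp add: fold_act_zero fun_eq_iff)
  then show "f * Poly_Mapping.single w c \<in> annihilator"
    by (simp add: annihilator_def lincomb_mult_single)
  show "Poly_Mapping.single w c * f \<in> annihilator"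
    using f by (simp add: annihilator_def lincomb_single_mult)
qed (auto simp: annihilator_def lincomb_add)

abbreviation "adjoined_relation \<equiv> {word [Elt p] * word [Q] - 1 :: 'r letter list \<Rightarrow>\<^sub>0 'k}"

text \<open>Only the generating relations need checking: those of \<open>R\<close> hold because
  \<open>Elt r\<close> acts by right multiplication, and \<open>pq = 1\<close> is
  \<open>act_Q_mult_p\<close>.\<close>

lemma adjoin_ideal_subset_annihilator: "adjoin_ideal scale adjoined_relation \<subseteq> annihilator"
proof (rule adjoin_ideal_minimal[OF ideal_annihilator])
  have "lincomb \<phi> (1 :: 'r letter list \<Rightarrow>\<^sub>0 'k) = \<phi> []" for \<phi> :: "'r letter list \<Rightarrow> 'r"
    using lincomb_single[of \<phi> "[]" 1] by (simp add: zero_list_def[symmetric] del: lincomb_single)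
  then show "algebra_relations scale \<union> adjoined_relation \<subseteq> annihilator"
    unfolding algebra_relations_def annihilator_def
    by (auto simp: lincomb_diff lincomb_add single_mult_single_list fscale_single act_Q_mult_p
        distrib_left scale_mult_right mult.assoc)
qed

section \<open>Irreducible words applied to the generator\<close>

definition start :: "'r letter list \<Rightarrow> 'r" where
  "start t = (if t = [] then 1 else 0)"

text \<open>For an irreducible word standing for \<open>u \<otimes> b\<close>: the reversal of \<open>u\<close>, and \<open>b \<in> B \<union> {1}\<close>.\<close>

definition stem_tail :: "'r letter list \<Rightarrow> 'r letter list \<times> 'r" where
  "stem_tail w = (case rev w of Elt b # s \<Rightarrow> (s, b) | s \<Rightarrow> (s, 1))"

text \<open>Supports induction on the last letter. After a letter from the basis the forbidden pairs
  \<open>xy\<close> leave only \<open>Q\<close>, and the forbidden pairs \<open>(xp) q\<close> then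
  exclude \<open>Bpp\<close> for the letter before it.\<close>

lemma irreducible_words_snocD:
  assumes "w @ [a] \<in> irreducible_words basis Bpp"
  shows "w \<in> irreducible_words basis Bpp" and "a \<in> generators basis"
    and "w = u @ [Elt b] \<Longrightarrow> a = Q \<and> b \<in> Bpm"
proof -
  show "w \<in> irreducible_words basis Bpp" "a \<in> generators basis"
    using assms sublist_order.order_trans[of _ w "w @ [a]"] unfolding irreducible_words_def by auto
  assume w: "w = u @ [Elt b]"
  have sub: "sublist [Elt b, a] (w @ [a])"
    unfolding w by (simp add: sublist_appendI)
  have b: "b \<in> basis"
    using assms unfolding irreducible_words_def w generators_def by auto
  with assms sub show "a = Q \<and> b \<in> Bpm"
    unfolding irreducible_words_def generators_def by auto
qed

lemma snd_stem_tail: "w \<in> irreducible_words basis Bpp \<Longrightarrow> snd (stem_tail w) \<in> insert 1 basis"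
  by (cases w rule: rev_cases)
    (auto simp: stem_tail_def generators_def dest: irreducible_words_snocD(2) split: letter.split)

text \<open>Since 1 is not in the basis, tail 1 unambiguously marks a word that is empty or ends in
  \<open>Q\<close>.\<close>

lemma stem_tail_inverse:
  assumes "w \<in> irreducible_words basis Bpp"
  shows "(case stem_tail w of (s, b) \<Rightarrow> rev s @ (if b = 1 then [] else [Elt b])) = w"
proof (cases w rule: rev_cases)
  case (snoc u a)
  with assms have "a \<in> generators basis"
    using irreducible_words_snocD(2) by blast
  then show ?thesis
    using one_notin_B by (auto simp: snoc stem_tail_def generators_def)
qed (simp add: stem_tail_def)

lemma inj_on_stem_tail: "inj_on stem_tail (irreducible_words basis Bpp)"
  using stem_tail_inverse by (rule inj_on_inverseI)

lemma fold_act_start: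
  assumes "w \<in> irreducible_words basis Bpp"
  shows "fold act w start = (\<lambda>t. if t = fst (stem_tail w) then snd (stem_tail w) else 0)"
  using assms
proof (induction w rule: rev_induct)
  case Nil
  show ?case by (simp add: start_def fun_eq_iff stem_tail_def)
next
  case (snoc a w)
  note D = irreducible_words_snocD[OF snoc.prems]
  have IH: "fold act w start = (\<lambda>t. if t = fst (stem_tail w) then snd (stem_tail w) else 0)"
    using D(1) by (rule snoc.IH)
  have zero: "left_factor 0 = 0" "coef 0 c = 0" for c
    by (simp_all add: self.linear_0[OF linear_left_factor] representation_zero)
  show ?case
  proof (cases a)
    case (Elt r)
    \<comment> \<open>Two adjacent basis letters are forbidden, so \<open>w\<close> is empty or ends
      in \<open>Q\<close>; its entry 1 is simply multiplied by \<open>r\<close>.\<close>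
    then have "stem_tail w = (rev w, 1)"
      using D(3) by (cases w rule: rev_cases) (auto simp: stem_tail_def split: letter.split)
    with Elt show ?thesis
      by (auto simp: IH stem_tail_def fun_eq_iff)
  next
    case Q
    have eq: "fold act (w @ [a]) start =
        act Q (\<lambda>t. if t = fst (stem_tail w) then snd (stem_tail w) else 0)"
      by (simp add: Q IH)
    show ?thesis
    proof (cases "\<exists>u b. w = u @ [Elt b]")
      case True
      then obtain u b where w: "w = u @ [Elt b]" by blast
      \<comment> \<open>As \<open>b\<close> lies in \<open>Bpm\<close>, \<open>left_factor\<close>
        kills it, and only its \<open>b\<close>-coordinate 1 moves on, to the address
        \<open>Q # Elt b # s\<close>.\<close>
      with D(3) have b: "b \<in> Bpm" by blast
      then have "b \<notin> Bpp" "b \<noteq> 1"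
        using one_notin_B Bpp_Bpm_disjoint by auto
      with b have b': "left_factor b = 0" "coef b c = (if c = b then 1 else 0)" "1 \<noteq> b" for c
        by (simp_all add: left_factor_basis coef_basis)
      show ?thesis
        unfolding eq unfolding Q by (auto simp: fun_eq_iff stem_tail_def w act_def b b' zero split: list.splits letter.splits)
    next
      case False
      \<comment> \<open>Here \<open>w\<close> is empty or ends in \<open>Q\<close>;
        \<open>left_factor\<close> kills the entry 1, whose 1-coordinate moves to the address
        \<open>Q # rev w\<close>.\<close>
      then have "stem_tail w = (rev w, 1)"
        by (cases w rule: rev_cases) (auto simp: stem_tail_def split: letter.split)
      moreover have "left_factor 1 = 0" "coef 1 1 = 1" "c \<in> Bpm \<Longrightarrow> coef 1 c = 0" for c
        using one_notin_B by (auto simp: left_factor_basis coef_basis)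
      ultimately show ?thesis
        unfolding eq unfolding Q
        by (auto simp: fun_eq_iff stem_tail_def act_def zero split: list.splits letter.splits)
    qed
  qed
qed

text \<open>Applied to \<open>start\<close>, \<open>f\<close> gives zero. By injectivity of
  \<open>stem_tail\<close>, the coordinate \<open>b\<close> at address \<open>s\<close> of this
  vector is exactly the coefficient of the word with stem \<open>s\<close> and tail
  \<open>b\<close>.\<close>

lemma adjoin_ideal_irreducible_words:
  assumes "f \<in> adjoin_ideal scale adjoined_relation"
    and "Poly_Mapping.keys f \<subseteq> irreducible_words basis Bpp"
  shows "f = 0"
proof (rule poly_mapping_eqI)
  fix w
  show "Poly_Mapping.lookup f w = Poly_Mapping.lookup 0 w"
  proof (cases "w \<in> Poly_Mapping.keys f")
    case True
    obtain s b where sb: "stem_tail w = (s, b)" by force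
    have w: "w \<in> irreducible_words basis Bpp" using True assms(2) by blast
    have "0 = lincomb (\<lambda>w. fold act w start s) f"
      using assms(1) adjoin_ideal_subset_annihilator by (auto simp: annihilator_def)
    then have "0 = coef (lincomb (\<lambda>w. fold act w start s) f) b"
      using coef_sum[of _ _ "{}"] by simp
    also have "\<dots> = (\<Sum>w'\<in>Poly_Mapping.keys f. Poly_Mapping.lookup f w' * coef (fold act w' start s) b)"
      unfolding lincomb_def by (rule coef_sum)
    also have "\<dots> = (\<Sum>w'\<in>Poly_Mapping.keys f. if w' = w then Poly_Mapping.lookup f w' else 0)"
    proof (rule sum.cong[OF refl])
      fix w' assume "w' \<in> Poly_Mapping.keys f"
      then have w': "w' \<in> irreducible_words basis Bpp" using assms(2) by blast
      have "coef (fold act w' start s) b = (if stem_tail w' = (s, b) then 1 else 0)"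
        using coef_sum[of _ _ "{}"] coef_basis[OF snd_stem_tail[OF w']]
        by (auto simp: fold_act_start[OF w'] prod_eq_iff)
      also have "\<dots> = (if w' = w then 1 else 0)"
        using inj_on_eq_iff[OF inj_on_stem_tail w' w] sb by simp
      finally show "Poly_Mapping.lookup f w' * coef (fold act w' start s) b =
        (if w' = w then Poly_Mapping.lookup f w' else 0)" by simp
    qed
    also have "\<dots> = Poly_Mapping.lookup f w"
      using True by simp
    finally show ?thesis by simp
  qed (simp add: in_keys_iff)
qed


section \<open>The two presentations and reduction to normal form\<close>

text \<open>\<open>pqp - p\<close> is \<open>(pq - 1) p\<close>; conversely, multiplying
  \<open>pqp = p\<close> on the right by \<open>y\<close> gives \<open>pq = 1\<close>.\<close>

lemma adjoin_ideal_relation_eq: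
  "adjoin_ideal scale {word [Elt p] * word [Q] * word [Elt p] - word [Elt p]} =
    adjoin_ideal scale adjoined_relation" (is "adjoin_ideal scale ?S = _")
proof (intro subset_antisym adjoin_ideal_minimal ideal_adjoin_ideal Un_least)
  have "(word [Elt p] * word [Q] - 1) * word [Elt p] \<in> adjoin_ideal scale adjoined_relation"
    using adjoin_ideal_superset by (intro adj.right_closed) blast
  then show "?S \<subseteq> adjoin_ideal scale adjoined_relation"
    by (simp add: algebra_simps)
  have 1: "adj.cong ?S (word [Elt p] * word [Elt y]) 1"
    using adj.cong_sym[OF Elt_mult[of ?S p y]] Elt_one[of ?S] unfolding p_y
    by (rule adj.cong_trans)
  have 2: "adj.cong ?S (word [Elt p] * word [Q] * word [Elt p]) (word [Elt p])"
    using adjoin_ideal_superset[of ?S] by (simp add: adj.cong_def)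
  have "adj.cong ?S (word [Elt p] * word [Q] * 1) (word [Elt p] * word [Q] * (word [Elt p] * word [Elt y]))"
    by (intro adj.cong_mult adj.cong_refl adj.cong_sym[OF 1])
  also have "word [Elt p] * word [Q] * (word [Elt p] * word [Elt y]) =
      (word [Elt p] * word [Q] * word [Elt p] * word [Elt y] :: 'r letter list \<Rightarrow>\<^sub>0 'k)"
    by (simp add: mult.assoc)
  also have "adj.cong ?S \<dots> (word [Elt p] * word [Elt y])"
    by (intro adj.cong_mult adj.cong_refl 2)
  also note 1
  finally show "adjoined_relation \<subseteq> adjoin_ideal scale ?S"
    by (simp add: adj.cong_def)
qed (use adjoin_ideal_superset in blast)+

text \<open>The first kind of reduction is multiplication in \<open>R\<close>; the second holds
  because \<open>(xp) q = x (pq) = x\<close>.\<close>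

lemma reduction_system_cong:
  assumes "(W, f) \<in> reduction_system scale p basis Bpp"
  shows "adj.cong adjoined_relation (word W) f"
proof -
  have expand: "adj.cong adjoined_relation (word [Elt r]) (expand scale basis r)" for r
    by (rule Elt_expand) (simp_all add: independent_insert_one span_insert_one)
  have xy: "adj.cong adjoined_relation (word [Elt x, Elt z]) (expand scale basis (x * z))" for x z
    using adj.cong_trans[OF adj.cong_sym[OF Elt_mult] expand]
    by (simp add: single_mult_single_list)
  have xpq: "adj.cong adjoined_relation (word [Elt (x * p), Q]) (expand scale basis x)" for x
  proof -
    have "adj.cong adjoined_relation (word [Elt (x * p)] * word [Q]) (word [Elt x] * word [Elt p] * word [Q])"
      by (intro adj.cong_mult adj.cong_refl Elt_mult)
    also have "word [Elt x] * word [Elt p] * word [Q] =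
        (word [Elt x] * (word [Elt p] * word [Q]) :: 'r letter list \<Rightarrow>\<^sub>0 'k)"
      by (simp add: mult.assoc)
    also have "adj.cong adjoined_relation \<dots> (word [Elt x] * 1)"
      using adjoin_ideal_superset[of adjoined_relation]
      by (intro adj.cong_mult adj.cong_refl) (simp add: adj.cong_def)
    also have "adj.cong adjoined_relation \<dots> (expand scale basis x)"
      using expand by simp
    finally show ?thesis
      by (simp add: single_mult_single_list)
  qed
  show ?thesis
    using assms xy xpq unfolding reduction_system_def by auto
qed

text \<open>Every element of \<open>Bpp\<close> has the form \<open>x * p\<close>, so the forbidden
  pairs are exactly the left-hand sides of reductions.\<close>

lemma irreducible_words_alt:
  "irreducible_words basis Bpp =
    lists (generators basis) - {w. \<exists>(W, f)\<in>reduction_system scale p basis Bpp. sublist W w}"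
proof -
  have "\<exists>x. b = x * p" if "b \<in> Bpp" for b
    using Bpp_y_p[OF that] by metis
  then show ?thesis
    unfolding irreducible_words_def reduction_system_def by fastforce
qed

text \<open>Left-hand sides have length 2 and right-hand sides involve only shorter words in the
  generators, so reduction terminates within these words and preserves the class.\<close>

lemma normal_form:
  assumes "Poly_Mapping.keys f \<subseteq> lists (generators basis)"
  shows "\<exists>g. (reduces (reduction_system scale p basis Bpp))\<^sup>*\<^sup>* f g
    \<and> Poly_Mapping.keys g \<subseteq> irreducible_words basis Bpp \<and> adj.cong adjoined_relation g f"
proof -
  let ?S = "reduction_system scale p basis Bpp"
  have W: "length W = 2 \<and> (\<exists>r. h = expand scale basis r)" if "(W, h) \<in> ?S" for W h
    using that unfolding reduction_system_def by auto
  have short: "length w < length W" if "(W, h) \<in> ?S" "w \<in> Poly_Mapping.keys h" for W h w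
    using W[OF that(1)] that(2) keys_expand[of basis] by force
  have gen: "Poly_Mapping.keys h \<subseteq> lists (generators basis)" if "(W, h) \<in> ?S" for W h
  proof -
    have "\<exists>r. h = expand scale basis r"
      using W[OF that] by blast
    then obtain r where "h = expand scale basis r" ..
    moreover have "insert [] ((\<lambda>b. [Elt b]) ` basis) \<subseteq> lists (generators basis)"
      by (auto simp: generators_def)
    ultimately show ?thesis
      using keys_expand[of basis r] by blast
  qed
  have "\<exists>g. (reduces ?S)\<^sup>*\<^sup>* f g \<and> Poly_Mapping.keys g \<inter> {w. \<exists>(W, h)\<in>?S. sublist W w} = {}"
    by (rule length_decreasing_normal_form) (rule short)
  then obtain g where g: "(reduces ?S)\<^sup>*\<^sup>* f g"
    "Poly_Mapping.keys g \<inter> {w. \<exists>(W, h)\<in>?S. sublist W w} = {}"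
    by blast
  have "Poly_Mapping.keys g \<subseteq> lists (generators basis)"
    using g(1) assms gen by (rule rtranclp_reduces_keys_lists)
  with g(2) have "Poly_Mapping.keys g \<subseteq> irreducible_words basis Bpp"
    unfolding irreducible_words_alt by blast
  moreover have "adj.cong adjoined_relation g f"
    using g(1) reduction_system_cong by (rule adj.rtranclp_reduces_cong)
  ultimately show ?thesis
    using g(1) by blast
qed

lemma irreducible_words_spanning:
  "\<exists>g. Poly_Mapping.keys g \<subseteq> irreducible_words basis Bpp \<and> adj.cong adjoined_relation f g"
proof -
  obtain h where h: "Poly_Mapping.keys h \<subseteq> lists (generators basis)" "adj.cong adjoined_relation f h"
    using word_generators_spanning[OF independent_insert_one span_insert_one] by blast
  with normal_form[OF h(1)] show ?thesis
    using adj.cong_trans adj.cong_sym by blast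
qed

end

theorem mainTheorem6:
  fixes scale :: "'k::field \<Rightarrow> 'r::ring_1 \<Rightarrow> 'r"
    and p :: 'r
    and Bpp Bpm B :: "'r set"
    and S :: "('r letter list \<Rightarrow>\<^sub>0 'k) set"
  assumes "assoc_algebra scale"
    and "1 \<in> {p * x | x. True}"
    and "1 \<notin> {x * p | x. True}"
    and "basis_of scale {x * p | x. True} Bpp"
    and "p \<in> Bpp"
    and "relative_basis_of scale {x * p + z | x z. z \<in> module.span scale {1}} UNIV Bpm"
    and "B = Bpp \<union> Bpm"
    and "S = {word [Elt p] * word [Q] * word [Elt p] - word [Elt p]}"
  shows "{x * p | x. True} = {p * x * p | x. True} \<and>
    {p * x | x. True} = UNIV \<and>
    1 \<notin> B \<and> basis_of scale UNIV (insert 1 B) \<and>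
    adjoin scale S = adjoin scale {word [Elt p] * word [Q] - 1} \<and>
    inj_on (\<lambda>w. adjoin_class scale S (word w)) (irreducible_words B Bpp) \<and>
    carrier_basis (adjoin scale S)
      ((\<lambda>w. adjoin_class scale S (word w)) ` irreducible_words B Bpp) \<and>
    (\<forall>f. Poly_Mapping.keys f \<subseteq> lists (generators B) \<longrightarrow>
      (\<exists>g. (reduces (reduction_system scale p B Bpp))\<^sup>*\<^sup>* f g
        \<and> Poly_Mapping.keys g \<subseteq> irreducible_words B Bpp
        \<and> adjoin_class scale S g = adjoin_class scale S f))"
proof -
  obtain y where y: "p * y = 1"
    using assms(2) by fastforce
  interpret right_invertible_bases scale p y Bpp Bpm
    using y assms(1,3,4,6) by (simp add: right_invertible_bases.intro right_invertible_bases_axioms.intro)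
  have B: "B = Bpp \<union> Bpm" by fact
  \<comment> \<open>All claims about the quotient depend on \<open>S\<close> only through the ideal,
    so \<open>pq = 1\<close> may replace \<open>pqp = p\<close>.\<close>
  have eq: "adjoin_ideal scale S = adjoin_ideal scale adjoined_relation"
    unfolding assms(8) by (rule adjoin_ideal_relation_eq)
  \<comment> \<open>Inserting \<open>p * y = 1\<close> on the left puts any element into
    \<open>pR\<close>, which gives \<open>Rp = pRp\<close> and \<open>pR = R\<close>.\<close>
  have "x * p = p * (y * x) * p" "x = p * (y * x)" for x
    using y by (simp_all flip: mult.assoc)
  then have "{x * p | x. True} = {p * x * p | x. True}" "{p * x | x. True} = UNIV"
    by blast+
  moreover have "1 \<notin> B" "basis_of scale UNIV (insert 1 B)"
    using one_notin_B independent_insert_one span_insert_one by (simp_all add: B basis_of_def)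
  moreover have "adjoin scale S = adjoin scale {word [Elt p] * word [Q] - 1}"
    unfolding adjoin_def eq ..
  moreover have "inj_on (\<lambda>w. adjoin_class scale S (word w)) (irreducible_words B Bpp)"
    unfolding adjoin_class_def eq B
    by (rule adj.inj_on_free_class_word) (rule adjoin_ideal_irreducible_words)
  moreover have "carrier_basis (adjoin scale S)
      ((\<lambda>w. adjoin_class scale S (word w)) ` irreducible_words B Bpp)"
    unfolding adjoin_class_def adjoin_def eq B
    by (rule adj.carrier_basis_free_class_words)
      (rule irreducible_words_spanning, rule adjoin_ideal_irreducible_words)
  moreover have "\<exists>g. (reduces (reduction_system scale p B Bpp))\<^sup>*\<^sup>* f g
        \<and> Poly_Mapping.keys g \<subseteq> irreducible_words B Bpp
        \<and> adjoin_class scale S g = adjoin_class scale S f"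
    if "Poly_Mapping.keys f \<subseteq> lists (generators B)" for f
    using normal_form[of f] that
    unfolding adjoin_class_def eq B adj.free_class_eq_iff by blast
  ultimately show ?thesis by blast
qed

end
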